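(* Let $m,n,k \geq 2$. Then the poset $\mathbb{P}=m \oplus n \oplus k$ is not 3-S\l upecki, and hence not S\l upecki.
   Context: Posets are viewed as reflexive digraphs with arc relation $\leq$. For $n\geq1$, $n$ also denotes the $n$-element antichain. The ordinal sum $\mathbb{P}\oplus\mathbb{Q}$ is the disjoint union of $\mathbb{P}$ and $\mathbb{Q}$ with additionally $p\leq q$ for all $p\in P$, $q\in Q$. A $k$-ary polymorphism of $\mathbb{P}$ is a monotone map $\mathbb{P}^k\to\mathbb{P}$ (product order); it is essentially unary if it equals $(x_1,\dots,x_k)\mapsto g(x_i)$ for some $i$ and some monotone $g:\mathbb{P}\to\mathbb{P}$. $\mathbb{P}$ is $k$-S\l upecki if every surjective $k$-ary polymorphism is essentially unary, and S\l upecki if it is $k$-S\l upecki for all $k\geq2$. *)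

theory Defs
  imports Main "HOL-Library.FuncSet"
begin

text \<open>
  A poset is its order relation \<open>r :: 'a rel\<close>, with \<open>Partial_order r\<close>. Since \<open>r\<close> is
  reflexive, its carrier is recovered as \<open>Field r\<close>.
\<close>

definition antichain :: "nat \<Rightarrow> nat rel" where
  "antichain n = Id_on {..<n}"

definition ordinal_sum :: "'a rel \<Rightarrow> 'b rel \<Rightarrow> ('a + 'b) rel"  (infixr "\<oplus>\<^sub>o" 65) where
  "r \<oplus>\<^sub>o s = {(Inl a, Inl a') | a a'. (a, a') \<in> r} \<union> {(Inr b, Inr b') | b b'. (b, b') \<in> s}
            \<union> {(Inl a, Inr b) | a b. a \<in> Field r \<and> b \<in> Field s}"

text \<open>
  Elements of the \<open>k\<close>-th power are the extensional functions on \<open>{..<k}\<close>, so that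
  coordinates are numbered from \<open>0\<close> and distinct functions are distinct tuples.
\<close>

definition power_carrier :: "nat \<Rightarrow> 'a rel \<Rightarrow> (nat \<Rightarrow> 'a) set" where
  "power_carrier k r = {..<k} \<rightarrow>\<^sub>E Field r"

definition power_le :: "nat \<Rightarrow> 'a rel \<Rightarrow> (nat \<Rightarrow> 'a) \<Rightarrow> (nat \<Rightarrow> 'a) \<Rightarrow> bool" where
  "power_le k r x y \<longleftrightarrow> (\<forall>i<k. (x i, y i) \<in> r)"

definition polymorphism :: "nat \<Rightarrow> 'a rel \<Rightarrow> ((nat \<Rightarrow> 'a) \<Rightarrow> 'a) \<Rightarrow> bool" where
  "polymorphism k r f \<longleftrightarrow> f \<in> power_carrier k r \<rightarrow> Field r
     \<and> monotone_on (power_carrier k r) (power_le k r) (\<lambda>a b. (a, b) \<in> r) f"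

definition essentially_unary :: "nat \<Rightarrow> 'a rel \<Rightarrow> ((nat \<Rightarrow> 'a) \<Rightarrow> 'a) \<Rightarrow> bool" where
  "essentially_unary k r f \<longleftrightarrow>
     (\<exists>i<k. \<exists>g. g \<in> Field r \<rightarrow> Field r
        \<and> monotone_on (Field r) (\<lambda>a b. (a, b) \<in> r) (\<lambda>a b. (a, b) \<in> r) g
        \<and> (\<forall>x\<in>power_carrier k r. f x = g (x i)))"

definition k_slupecki :: "nat \<Rightarrow> 'a rel \<Rightarrow> bool" where
  "k_slupecki k r \<longleftrightarrow>
     (\<forall>f. polymorphism k r f \<and> f ` power_carrier k r = Field r \<longrightarrow> essentially_unary k r f)"

definition slupecki :: "'a rel \<Rightarrow> bool" where
  "slupecki r \<longleftrightarrow> (\<forall>k\<ge>2. k_slupecki k r)"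

lemma Field_antichain [simp]: "Field (antichain n) = {..<n}"
  by (auto simp: antichain_def Field_def)

lemma Partial_order_antichain: "Partial_order (antichain n)"
  by (auto simp: antichain_def Field_def partial_order_on_def preorder_on_def refl_on_def
      trans_def antisym_def)

lemma Field_ordinal_sum [simp]: "Field (r \<oplus>\<^sub>o s) = Field r <+> Field s"
  by (force simp: ordinal_sum_def Field_def)

lemma Partial_order_ordinal_sum:
  assumes "Partial_order r" "Partial_order s"
  shows "Partial_order (r \<oplus>\<^sub>o s)"
proof -
  have r: "\<And>a. a \<in> Field r \<Longrightarrow> (a, a) \<in> r" "trans r" "antisym r"
    and s: "\<And>b. b \<in> Field s \<Longrightarrow> (b, b) \<in> s" "trans s" "antisym s"
    using assms by (auto simp: partial_order_on_def preorder_on_def refl_on_def)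
  have "trans (r \<oplus>\<^sub>o s)"
    by (rule transI) (auto simp: ordinal_sum_def intro: FieldI1 FieldI2 transD[OF r(2)] transD[OF s(2)])
  moreover have "antisym (r \<oplus>\<^sub>o s)"
    by (rule antisymI) (auto simp: ordinal_sum_def dest: antisymD[OF r(3)] antisymD[OF s(3)])
  moreover have "refl_on (Field (r \<oplus>\<^sub>o s)) (r \<oplus>\<^sub>o s)"
    unfolding refl_on_def Field_ordinal_sum using r(1) s(1) by (auto simp: ordinal_sum_def)
  moreover have "r \<oplus>\<^sub>o s \<subseteq> Field (r \<oplus>\<^sub>o s) \<times> Field (r \<oplus>\<^sub>o s)"
    by (auto simp del: Field_ordinal_sum intro: FieldI1 FieldI2)
  ultimately show ?thesis
    by (simp add: partial_order_on_def preorder_on_def)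
qed

end

theory Submission imports Defs begin

text \<open>
  In the ordinal sum of \<open>A\<close>, \<open>B\<close> and \<open>C\<close>, a value in \<open>A\<close> may be spread over a downset of the
  cube and a value in \<open>C\<close> over an upset. Reading \<open>A\<close>-values off the first coordinate and
  \<open>C\<close>-values off the third, every triple in \<open>A \<times> B \<times> C\<close> has only \<open>A\<close>-valued triples below it and
  \<open>C\<close>-valued ones above it, apart from other triples in \<open>A \<times> B \<times> C\<close>. So the middle coordinate
  can be returned there, which makes the map surjective, and a fixed \<open>b \<in> B\<close> wherever neither
  rule applies.
\<close>

fun layer_select :: "'b \<Rightarrow> 'a + 'b + 'c \<Rightarrow> 'a + 'b + 'c \<Rightarrow> 'a + 'b + 'c \<Rightarrow> 'a + 'b + 'c" where
  "layer_select b (Inl x) (Inl y) (Inr (Inr z)) = Inl x"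
| "layer_select b (Inl x) (Inr (Inl y)) (Inr (Inr z)) = Inr (Inl y)"
| "layer_select b (Inl x) (Inr (Inr y)) (Inr (Inr z)) = Inr (Inr z)"
| "layer_select b (Inl x) y z = Inl x"
| "layer_select b (Inr x) y (Inr (Inr z)) = Inr (Inr z)"
| "layer_select b (Inr x) y z = Inr (Inl b)"

lemma ordinal_sum_iffs [simp]:
  "(Inl a, Inl a') \<in> r \<oplus>\<^sub>o s \<longleftrightarrow> (a, a') \<in> r"
  "(Inr c, Inr c') \<in> r \<oplus>\<^sub>o s \<longleftrightarrow> (c, c') \<in> s"
  "(Inl a, Inr c) \<in> r \<oplus>\<^sub>o s \<longleftrightarrow> a \<in> Field r \<and> c \<in> Field s"
  "(Inr c, Inl a) \<notin> r \<oplus>\<^sub>o s"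
  by (auto simp: ordinal_sum_def)

lemma layer_select_in_Field:
  assumes "b \<in> Field s"
    and "x \<in> Field (r \<oplus>\<^sub>o s \<oplus>\<^sub>o t)" "y \<in> Field (r \<oplus>\<^sub>o s \<oplus>\<^sub>o t)" "z \<in> Field (r \<oplus>\<^sub>o s \<oplus>\<^sub>o t)"
  shows "layer_select b x y z \<in> Field (r \<oplus>\<^sub>o s \<oplus>\<^sub>o t)"
  using assms by (cases "(b, x, y, z)" rule: layer_select.cases) auto

text \<open>The arguments with values in A form a downset and those with values in C an upset.
  Values in B arise on A x B x C, or as \<open>b\<close> when \<open>x\<close> is outside A and
  \<open>z\<close> outside C. No triple of one kind is comparable to one of the other, so
  \<open>y\<close> and \<open>b\<close> are never compared.\<close>

lemma layer_select_mono:
  assumes "(b, b) \<in> s"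
    and "(x, x') \<in> r \<oplus>\<^sub>o s \<oplus>\<^sub>o t" "(y, y') \<in> r \<oplus>\<^sub>o s \<oplus>\<^sub>o t" "(z, z') \<in> r \<oplus>\<^sub>o s \<oplus>\<^sub>o t"
  shows "(layer_select b x y z, layer_select b x' y' z') \<in> r \<oplus>\<^sub>o s \<oplus>\<^sub>o t"
proof -
  \<comment> \<open>Comparisons across layers ask for membership in the fields, and
    \<open>b\<close>, \<open>y\<close>, \<open>y'\<close> can occur there as values.\<close>
  have "b \<in> Field s" "y \<in> Field (r \<oplus>\<^sub>o s \<oplus>\<^sub>o t)" "y' \<in> Field (r \<oplus>\<^sub>o s \<oplus>\<^sub>o t)"
    using assms by (blast intro: FieldI1 FieldI2)+
  with assms show ?thesis
    by (cases "(b, x, y, z)" rule: layer_select.cases;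
        cases "(b, x', y', z')" rule: layer_select.cases)
      (auto intro: FieldI1 FieldI2)
qed

text \<open>\<open>layer_select\<close> tests only which layers its arguments lie in and returns an
  argument or \<open>b\<close>, so general layers can be treated at once, antichains being an
  instance.\<close>

theorem ordinal_sum3_not_3_slupecki:
  fixes r :: "'a rel" and s :: "'b rel" and t :: "'c rel"
  assumes "Partial_order s" and "Field r \<noteq> {}" "Field s \<noteq> {}" "Field t \<noteq> {}"
  shows "\<not> k_slupecki 3 (r \<oplus>\<^sub>o s \<oplus>\<^sub>o t)"
proof
  let ?P = "r \<oplus>\<^sub>o s \<oplus>\<^sub>o t"
  assume *: "k_slupecki 3 ?P"
  obtain a b c where abc: "a \<in> Field r" "b \<in> Field s" "c \<in> Field t"
    using assms by blast
  have bb: "(b, b) \<in> s"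
    using assms(1) abc(2) by (simp add: partial_order_on_def preorder_on_def refl_on_def)
  define f where "f x = layer_select b (x 0) (x 1) (x 2)" for x :: "nat \<Rightarrow> 'a + 'b + 'c"
  define triple where
    "triple x y z = (\<lambda>i\<in>{..<3::nat}. if i = 0 then x else if i = 1 then y else z)"
    for x y z :: "'a + 'b + 'c"
  have triple_nth [simp]: "triple x y z 0 = x" "triple x y z (Suc 0) = y" "triple x y z 2 = z"
    for x y z by (simp_all add: triple_def)
  have triple_in: "triple x y z \<in> power_carrier 3 ?P"
    if "x \<in> Field ?P" "y \<in> Field ?P" "z \<in> Field ?P" for x y z
    using that unfolding triple_def power_carrier_def by (auto simp del: Field_ordinal_sum)
  have f_triple [simp]: "f (triple x y z) = layer_select b x y z" for x y z
    by (simp add: f_def)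
  have poly: "polymorphism 3 ?P f"
    unfolding polymorphism_def
  proof
    show "f \<in> power_carrier 3 ?P \<rightarrow> Field ?P"
      unfolding f_def power_carrier_def
      by (intro funcsetI layer_select_in_Field abc(2)) (rule PiE_mem, assumption, simp)+
    show "monotone_on (power_carrier 3 ?P) (power_le 3 ?P) (\<lambda>a b. (a, b) \<in> ?P) f"
      unfolding f_def power_le_def by (intro monotone_onI layer_select_mono bb) simp_all
  qed
  have "w \<in> f ` power_carrier 3 ?P" if w: "w \<in> Field ?P" for w
  proof -
    have ac: "Inl a \<in> Field ?P" "Inr (Inr c) \<in> Field ?P"
      using abc by auto
    consider x where "w = Inl x" | y where "w = Inr (Inl y)" | z where "w = Inr (Inr z)"
      by (metis sum.exhaust)
    \<comment> \<open>The diagonal yields all of A and C but collapses B to \<open>b\<close>; a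
      value in B is recovered as the middle coordinate between \<open>a\<close> and
      \<open>c\<close>.\<close>
    then have "w = layer_select b w w w \<or> w = layer_select b (Inl a) w (Inr (Inr c))"
      by cases auto
    then show ?thesis
      using triple_in[OF w w w] triple_in[OF ac(1) w ac(2)] by (metis f_triple imageI)
  qed
  then have "f ` power_carrier 3 ?P = Field ?P"
    using poly by (auto simp: polymorphism_def simp del: Field_ordinal_sum)
  with * poly have "essentially_unary 3 ?P f"
    by (auto simp: k_slupecki_def)
  then obtain i g where i: "i < 3" and g: "\<forall>x\<in>power_carrier 3 ?P. f x = g (x i)"
    by (auto simp: essentially_unary_def)
  \<comment> \<open>The third triple below differs from the first only in coordinate 1 and from the
    second only in coordinate 2, and \<open>f\<close> changes both times. The first pair excludes
    \<open>i = 0\<close> and \<open>i = 2\<close>, the second \<open>i = 1\<close>.\<close>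
  let ?A = "Inl a" and ?B = "Inr (Inl b)" and ?C = "Inr (Inr c)"
  have "triple ?A ?A ?C \<in> power_carrier 3 ?P" "triple ?A ?B ?B \<in> power_carrier 3 ?P"
    "triple ?A ?B ?C \<in> power_carrier 3 ?P"
    using abc by (auto intro!: triple_in)
  then have eqs: "Inl a = g (triple ?A ?A ?C i)" "Inl a = g (triple ?A ?B ?B i)"
    "Inr (Inl b) = g (triple ?A ?B ?C i)"
    using g by (metis f_triple layer_select.simps)+
  consider "i = 0" | "i = Suc 0" | "i = 2"
    using i by linarith
  then show False
    using eqs by cases (metis triple_nth sum.distinct(1))+
qed

theorem theorem5p2:
  fixes m n k :: nat
  assumes "m \<ge> 2" and "n \<ge> 2" and "k \<ge> 2"
  shows "\<not> k_slupecki 3 (antichain m \<oplus>\<^sub>o antichain n \<oplus>\<^sub>o antichain k)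
       \<and> \<not> slupecki (antichain m \<oplus>\<^sub>o antichain n \<oplus>\<^sub>o antichain k)"
proof -
  have "\<not> k_slupecki 3 (antichain m \<oplus>\<^sub>o antichain n \<oplus>\<^sub>o antichain k)"
    using assms by (intro ordinal_sum3_not_3_slupecki Partial_order_antichain)
      (auto simp: lessThan_empty_iff)
  moreover have "(2::nat) \<le> 3"
    by simp
  ultimately show ?thesis
    unfolding slupecki_def by blast
qed

end
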